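(* Let $G:[0,1]\to[0,1]$ be the Gauss map. If $\mu$ is a Borel probability measure on $[0,1]\setminus\mathbb{Q}$ that is invariant with respect to $G$ and whose Lyapunov exponent $\chi_\mu(G)=\int\log|G'|\,d\mu$ is finite, then $\mu$ is extremal.
   Context: The Gauss map is $G(x)=\frac1x-\lfloor 1/x\rfloor$ for $x>0$, and $G(0)=0$. A measure $\mu$ is invariant with respect to $G$ if $\mu\circ G^{-1}=\mu$. For $\psi:\mathbb{N}\to(0,\infty)$, an irrational $x$ is $\psi$-approximable if there exist infinitely many rationals $p/q$ (in lowest terms, $q\ge 1$) such that $|x-p/q|\le\psi(q)$. An irrational $x$ is very well approximable if there exists $c>0$ such that $x$ is $\psi$-approximable for $\psi(q)=q^{-(2+c)}$. A measure $\mu$ is extremal if the set of very well approximable numbers is $\mu$-null. *)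

theory Defs
  imports "HOL-Probability.Probability"
begin

definition gauss_map :: "real \<Rightarrow> real" where
  "gauss_map x = (if x > 0 then 1 / x - of_int \<lfloor>1 / x\<rfloor> else 0)"

definition invariant_measure :: "('a \<Rightarrow> 'a) \<Rightarrow> 'a measure \<Rightarrow> bool" where
  "invariant_measure f M \<longleftrightarrow> (\<forall>A\<in>sets M. emeasure M (f -` A \<inter> space M) = emeasure M A)"

text \<open>Coprimality together with \<open>q \<ge> 1\<close> makes the pairs \<open>(p, q)\<close> correspond bijectively to
  the rationals.\<close>
definition psi_approximable :: "(nat \<Rightarrow> real) \<Rightarrow> real \<Rightarrow> bool" where
  "psi_approximable \<psi> x \<longleftrightarrow> x \<notin> \<rat> \<and>
     infinite {(p :: int, q :: nat). q \<ge> 1 \<and> coprime p (int q) \<and>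
                 \<bar>x - of_int p / real q\<bar> \<le> \<psi> q}"

definition very_well_approximable :: "real \<Rightarrow> bool" where
  "very_well_approximable x \<longleftrightarrow>
     (\<exists>c>0. psi_approximable (\<lambda>q. real q powr (- (2 + c))) x)"

definition extremal :: "real measure \<Rightarrow> bool" where
  "extremal M \<longleftrightarrow> {x \<in> space M. very_well_approximable x} \<in> null_sets M"

end

theory Submission
  imports Defs
begin

text \<open>Let \<open>x\<^sub>n\<close> be the \<open>n\<close>-th iterate of \<open>x\<close> under the Gauss map. The substitution
  \<open>(q, p, x) \<mapsto> (p, q - a p, G x)\<close> with \<open>a = \<lfloor>1/x\<rfloor>\<close> is a Euclidean descent that divides
  \<open>\<bar>q x - p\<bar>\<close> by \<open>x\<close>; following it shows that every fraction \<open>p/q\<close> satisfies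
  \<open>q\<^sup>2 \<bar>x - p/q\<bar> \<ge> x\<^sub>n/4\<close> for some \<open>n\<close> that is at most logarithmic in \<open>q\<close>.
  On the other hand \<open>ln \<bar>G'\<bar> = -2 ln x\<close>, so by invariance and integrability the sum over \<open>n\<close> of
  \<open>\<mu> (- ln x\<^sub>n > \<epsilon> n)\<close> is finite, and by Borel--Cantelli \<open>x\<^sub>n\<close> almost surely decays
  subexponentially. Hence almost surely \<open>\<bar>x - p/q\<bar> \<le> q powr -(2 + c)\<close> bounds \<open>q\<close>.\<close>

section \<open>Euclidean descent along the Gauss map\<close>

lemma gauss_map_irrational:
  fixes x :: real
  assumes "0 < x" "x < 1" "x \<notin> \<rat>"
  obtains a :: int where "a \<ge> 1" "0 < gauss_map x" "gauss_map x < 1" "gauss_map x \<notin> \<rat>"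
    "gauss_map x = 1 / x - of_int a" "of_int a * x + x * gauss_map x = 1"
proof
  let ?a = "\<lfloor>1 / x\<rfloor>"
  show g: "gauss_map x = 1 / x - of_int ?a"
    using assms by (simp add: gauss_map_def)
  show "?a \<ge> 1"
    using assms by (simp add: le_floor_iff)
  show irr: "gauss_map x \<notin> \<rat>"
  proof
    assume "gauss_map x \<in> \<rat>"
    then have "gauss_map x + of_int ?a \<in> \<rat>" by (intro Rats_add Rats_of_int)
    then have "inverse (1 / x) \<in> \<rat>" unfolding g by (intro Rats_inverse) simp
    with assms show False by simp
  qed
  then have "gauss_map x \<noteq> 0" by auto
  moreover have "gauss_map x \<ge> 0" unfolding g by linarith
  ultimately show "gauss_map x > 0" by simp
  show "gauss_map x < 1" unfolding g by linarith
  show "of_int ?a * x + x * gauss_map x = 1"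
    unfolding g using assms by (simp add: field_simps)
qed

lemma funpow_gauss_map_irrational:
  assumes "0 < x" "x < 1" "x \<notin> \<rat>"
  shows "0 < (gauss_map ^^ n) x \<and> (gauss_map ^^ n) x < 1 \<and> (gauss_map ^^ n) x \<notin> \<rat>"
proof (induction n)
  case (Suc n)
  then obtain a :: int where "0 < gauss_map ((gauss_map ^^ n) x)"
    "gauss_map ((gauss_map ^^ n) x) < 1" "gauss_map ((gauss_map ^^ n) x) \<notin> \<rat>"
    using gauss_map_irrational by blast
  then show ?case by simp
qed (use assms in auto)

text \<open>The two branches of the potential are chosen so that it never increases along the descent,
  during which the sign of \<open>q x - p\<close> alternates. The growth condition uses only
  \<open>(3/2)\<^sup>2 \<le> 3/2 + 1\<close>: the denominators grow at least like the Fibonacci numbers.\<close>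

lemma gauss_map_descent:
  fixes x :: real and p q :: int
  assumes "0 < x" "x < 1" "x \<notin> \<rat>" "p \<ge> 1" "q \<ge> 1"
  shows "\<exists>n. (3/2) ^ n \<le> 3/2 * real_of_int q + of_int p \<and>
    (gauss_map ^^ n) x / 4 \<le>
      (if of_int q * x < of_int p then of_int q * (of_int p - of_int q * x)
       else of_int p / x * (of_int q * x - of_int p))"
  using assms
proof (induction "nat q" arbitrary: q p x rule: less_induct)
  case less
  obtain a :: int where a: "a \<ge> 1" "0 < gauss_map x" "gauss_map x < 1" "gauss_map x \<notin> \<rat>"
    "gauss_map x = 1 / x - of_int a" "of_int a * x + x * gauss_map x = 1"
    using gauss_map_irrational less.prems by metis
  define y where "y = gauss_map x"
  define r where "r = q - a * p"
  have ra: "real_of_int r = of_int q - of_int a * of_int p" by (simp add: r_def)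
  have y: "0 < y" "y < 1" "y \<notin> \<rat>" "of_int a * x + x * y = 1"
    using a by (auto simp: y_def)
  have qp: "real_of_int q \<ge> 1" "real_of_int p \<ge> 1" "real_of_int a \<ge> 1"
    using less.prems a by auto
  have diff: "of_int p * y - of_int r = (of_int p - of_int q * x) / x"
    unfolding y_def a ra using less.prems by (simp add: field_simps)
  have ne: "of_int q * x \<noteq> of_int p"
  proof
    assume "of_int q * x = of_int p"
    then have "x = of_int p / of_int q" using qp by (simp add: field_simps)
    then show False using less.prems by simp
  qed
  \<comment> \<open>Both branches below reach the induction hypothesis for \<open>(p, r, y)\<close>
    through this fact. Since \<open>q = a p + r\<close> with \<open>a, r \<ge> 1\<close>, the
    denominator drops from \<open>q\<close> to \<open>p\<close>.\<close>
  have step: ?case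
    if "r \<ge> 1" and pot: "(if of_int p * y < of_int r then of_int p * (of_int r - of_int p * y)
       else of_int r / y * (of_int p * y - of_int r)) \<le>
       (if of_int q * x < of_int p then of_int q * (of_int p - of_int q * x)
       else of_int p / x * (of_int q * x - of_int p))"
  proof -
    have "p \<le> a * p" using a less.prems by simp
    then have q: "q \<ge> p + r" by (simp add: r_def)
    then have "nat p < nat q" using that less.prems by simp
    from less.hyps[OF this y(1-3) \<open>r \<ge> 1\<close> \<open>p \<ge> 1\<close>] obtain n where
      n: "(3/2) ^ n \<le> 3/2 * real_of_int p + of_int r"
      "(gauss_map ^^ n) y / 4 \<le>
        (if of_int p * y < of_int r then of_int p * (of_int r - of_int p * y)
         else of_int r / y * (of_int p * y - of_int r))" by blast
    have "(3/2) ^ Suc n \<le> 3/2 * (3/2 * real_of_int p + of_int r)"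
      using n(1) by simp
    also have "\<dots> \<le> 3/2 * (of_int p + of_int r) + of_int p"
      using qp(2) unfolding distrib_left by argo
    also have "\<dots> \<le> 3/2 * of_int q + of_int p"
      using q by simp
    finally have "(3/2) ^ Suc n \<le> 3/2 * real_of_int q + of_int p" .
    moreover have "(gauss_map ^^ Suc n) x = (gauss_map ^^ n) y"
      by (simp add: y_def funpow_swap1)
    ultimately show ?thesis using n(2) pot by (intro exI[of _ "Suc n"]) linarith
  qed
  show ?case
  proof (cases "of_int q * x < of_int p")
    case neg: True
    have d: "of_int p * y - of_int r > 0" unfolding diff using neg less.prems by simp
    show ?thesis
    proof (cases "r \<ge> 1")
      case True
      \<comment> \<open>Because \<open>a x + x y = 1\<close> and \<open>q x < p\<close>, one gets
        \<open>q x y = q - a q x \<ge> q - a p = r\<close>. So the new factor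
        \<open>r / (x y)\<close> in front of \<open>p - q x\<close> is at most the old factor
        \<open>q\<close>.\<close>
      have "of_int a * (of_int q * x) \<le> of_int a * of_int p"
        using neg qp by (intro mult_left_mono) auto
      moreover have "of_int q * (x * y) = of_int q - of_int a * (of_int q * x)"
        using y(4) by algebra
      ultimately have "of_int r \<le> of_int q * (x * y)" by (simp add: ra)
      then have "of_int r / (x * y) \<le> of_int q"
        using less.prems y by (simp add: divide_le_eq)
      then have "of_int r / (x * y) * (of_int p - of_int q * x) \<le>
          of_int q * (of_int p - of_int q * x)"
        using neg by (intro mult_right_mono) auto
      then have "of_int r / y * (of_int p * y - of_int r) \<le>
          of_int q * (of_int p - of_int q * x)"
        unfolding diff by (simp add: mult.commute)
      then show ?thesis using True neg d by (intro step) auto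
    next
      case False
      \<comment> \<open>The descent stops here because \<open>r\<close> is not positive. The bound
        is proved directly for \<open>n = 1\<close>, using \<open>1/2 \<le> a x < 1\<close>.\<close>
      have qap: "real_of_int q \<le> of_int a * of_int p" using False ra by linarith
      have ax: "of_int a * x < 1" using y less.prems by (smt (verit) mult_pos_pos)
      have "x * y < x * 1" using y less.prems by (intro mult_strict_left_mono) auto
      moreover have "1 * x \<le> of_int a * x" using qp less.prems by (intro mult_right_mono) auto
      ultimately have ax2: "of_int a * x \<ge> 1/2" using y by linarith
      \<comment> \<open>If \<open>q\<close> is at most half of \<open>a p\<close>, then
        \<open>q x \<le> p / 2\<close> and \<open>p - q x \<ge> 1/2\<close>. Otherwise only
        \<open>p - q x \<ge> p x y\<close> is available, but then \<open>q x \<ge> 1/4\<close>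
        compensates.\<close>
      have "y / 4 \<le> of_int q * (of_int p - of_int q * x)"
      proof (cases "2 * real_of_int q \<le> of_int a * of_int p")
        case True
        then have "2 * of_int q * x \<le> of_int a * of_int p * x"
          using less.prems by (intro mult_right_mono) auto
        also have "\<dots> = of_int a * x * of_int p" by simp
        also have "\<dots> \<le> 1 * of_int p" using ax qp by (intro mult_right_mono) auto
        finally have "1/2 \<le> of_int p - of_int q * x" using qp by linarith
        then have "1 * (1/2) \<le> of_int q * (of_int p - of_int q * x)"
          using qp by (intro mult_mono) auto
        then show ?thesis using y by linarith
      next
        case False
        have "of_int q * x \<le> of_int a * of_int p * x"
          using qap less.prems by (intro mult_right_mono) auto
        moreover have "of_int p * (x * y) = of_int p - of_int a * of_int p * x"
          using y(4) by algebra
        ultimately have "of_int p - of_int q * x \<ge> of_int p * (x * y)" by linarith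
        then have "of_int q * (of_int p * (x * y)) \<le> of_int q * (of_int p - of_int q * x)"
          using qp by (intro mult_left_mono) auto
        moreover have "1/4 \<le> of_int q * x"
        proof -
          have "1/2 * 1 \<le> of_int a * x * of_int p" using ax2 qp by (intro mult_mono) auto
          also have "\<dots> = of_int a * of_int p * x" by simp
          also have "\<dots> \<le> 2 * of_int q * x"
            using False less.prems by (intro mult_right_mono) auto
          finally show ?thesis by simp
        qed
        then have "1/4 * 1 * y \<le> of_int q * x * of_int p * y"
          using qp y by (intro mult_right_mono mult_mono) auto
        moreover have "of_int q * x * of_int p * y = of_int q * (of_int p * (x * y))" by simp
        ultimately show ?thesis by linarith
      qed
      then show ?thesis using neg qp by (intro exI[of _ 1]) (simp add: y_def)
    qed
  next
    case False
    with ne have pos: "of_int q * x > of_int p" by simp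
    \<comment> \<open>For \<open>q x > p\<close> the descent cannot stop:
      \<open>r > p y > 0\<close>. The two potentials are even equal in this case.\<close>
    have d: "of_int r - of_int p * y = (of_int q * x - of_int p) / x"
      using diff less.prems by (simp add: field_simps)
    moreover have "(of_int q * x - of_int p) / x > 0" using pos less.prems by simp
    ultimately have neg: "of_int p * y < of_int r" by linarith
    moreover have "of_int p * y > 0" using qp y by simp
    ultimately have "real_of_int r > 0" by linarith
    then have "r \<ge> 1" by linarith
    moreover have "of_int p * (of_int r - of_int p * y) =
        of_int p / x * (of_int q * x - of_int p)"
      unfolding d by simp
    ultimately show ?thesis using False neg by (intro step) auto
  qed
qed

text \<open>For \<open>1 \<le> p \<le> q\<close> this is the descent, whose second branch is
  harmless because \<open>p / x \<le> q\<close> when \<open>p \<le> q x\<close>. Every other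
  fraction is so far from \<open>x\<close> that \<open>n = 0\<close> works.\<close>

lemma gauss_map_approximation_lower_bound:
  fixes x :: real and p :: int and q :: nat
  assumes "0 < x" "x < 1" "x \<notin> \<rat>" "q \<ge> 1"
  obtains n where "(3/2) ^ n \<le> 4 * real q"
    "(gauss_map ^^ n) x / 4 \<le> real q ^ 2 * \<bar>x - of_int p / real q\<bar>"
proof -
  note bound = that
  have q: "real q \<ge> 1" using assms by simp
  have eq: "real q ^ 2 * \<bar>x - of_int p / real q\<bar> = real q * \<bar>real q * x - of_int p\<bar>"
  proof -
    have "real q * \<bar>x - of_int p / real q\<bar> = \<bar>real q * (x - of_int p / real q)\<bar>"
      by (simp add: abs_mult)
    also have "real q * (x - of_int p / real q) = real q * x - of_int p"
      using q by (simp add: field_simps)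
    finally show ?thesis by (simp add: power2_eq_square)
  qed
  have qx: "real q * x > 0" "real q * x < real q" using q assms by auto
  have triv: thesis if "x \<le> \<bar>real q * x - of_int p\<bar>"
  proof (rule bound[of 0])
    have "1 * x \<le> real q * \<bar>real q * x - of_int p\<bar>"
      using q that assms by (intro mult_mono) auto
    then show "(gauss_map ^^ 0) x / 4 \<le> real q ^ 2 * \<bar>x - of_int p / real q\<bar>"
      unfolding eq using assms by simp
  qed (use q in simp)
  consider "p \<le> 0" | "p \<ge> 1" "real_of_int p \<ge> real q + 1" | "p \<ge> 1" "p \<le> int q"
    by linarith
  then show thesis
  proof cases
    case 1
    have "1 * x \<le> real q * x" using q assms by (intro mult_right_mono) auto
    then show ?thesis using 1 qx by (intro triv) linarith
  next
    case 2
    then show ?thesis using qx assms by (intro triv) linarith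
  next
    case 3
    have "int q \<ge> 1" using assms by simp
    from gauss_map_descent[OF assms(1-3) 3(1) this]
    obtain n where n: "(3/2) ^ n \<le> 3/2 * real q + of_int p"
      "(gauss_map ^^ n) x / 4 \<le>
        (if real q * x < of_int p then real q * (of_int p - real q * x)
         else of_int p / x * (real q * x - of_int p))"
      unfolding of_int_of_nat_eq by blast
    show ?thesis
    proof (rule bound)
      show "(3/2) ^ n \<le> 4 * real q" using n(1) 3(2) by linarith
      have "(gauss_map ^^ n) x / 4 \<le> real q * \<bar>real q * x - of_int p\<bar>"
      proof (cases "real q * x < of_int p")
        case True
        then show ?thesis using n(2) by simp
      next
        case False
        then have "(gauss_map ^^ n) x / 4 \<le> of_int p / x * (real q * x - of_int p)"
          using n(2) by (simp only: if_False)
        also have "\<dots> \<le> real q * (real q * x - of_int p)"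
          using False assms by (intro mult_right_mono) (auto simp: divide_le_eq)
        finally show ?thesis using False by simp
      qed
      then show "(gauss_map ^^ n) x / 4 \<le> real q ^ 2 * \<bar>x - of_int p / real q\<bar>"
        unfolding eq .
    qed
  qed
qed

text \<open>Taking logarithms in the lower bound gives \<open>c ln q \<le> e n + K + ln 4\<close>
  with \<open>n\<close> of order at most \<open>ln q\<close>. For small \<open>e\<close> this bounds
  \<open>q\<close>.\<close>

lemma not_very_well_approximable:
  fixes x :: real
  assumes x: "0 < x" "x < 1" "x \<notin> \<rat>"
    and decay: "\<And>e. e > 0 \<Longrightarrow> \<exists>K. \<forall>n. - ln ((gauss_map ^^ n) x) \<le> e * real n + K"
  shows "\<not> very_well_approximable x"
proof
  assume "very_well_approximable x"
  then obtain c where c: "c > 0" and inf: "infinite {(p :: int, q :: nat). q \<ge> 1 \<and>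
      coprime p (int q) \<and> \<bar>x - of_int p / real q\<bar> \<le> real q powr (- (2 + c))}" (is "infinite ?S")
    unfolding very_well_approximable_def psi_approximable_def by blast
  define l where "l = ln (3/2 :: real)"
  have l: "l > 0" by (simp add: l_def)
  \<comment> \<open>With \<open>n l \<le> ln 4 + ln q\<close>, this rate makes \<open>e n\<close> at
    most \<open>c / 2 * (ln 4 + ln q)\<close>, so half of \<open>c ln q\<close> survives.\<close>
  define e where "e = c * l / 2"
  have "e > 0" using c l by (simp add: e_def)
  then obtain K where K: "\<And>n. - ln ((gauss_map ^^ n) x) \<le> e * real n + K"
    using decay by blast
  \<comment> \<open>Solves the surviving inequality for \<open>q\<close>. The first
    \<open>ln 4\<close> comes from \<open>(3/2) ^ n \<le> 4 q\<close>, the last from the divisor 4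
    under the iterate.\<close>
  define B where "B = exp ((c / 2 * ln 4 + K + ln 4) / (c / 2))"
  have bound: "real q \<le> B \<and> \<bar>real_of_int p\<bar> \<le> 2 * B" if "(p, q) \<in> ?S" for p q
  proof -
    from that have q: "q \<ge> 1" and
      le: "\<bar>x - of_int p / real q\<bar> \<le> real q powr (- (2 + c))" by auto
    have q': "real q \<ge> 1" using q by simp
    obtain n where n: "(3/2) ^ n \<le> 4 * real q"
      "(gauss_map ^^ n) x / 4 \<le> real q ^ 2 * \<bar>x - of_int p / real q\<bar>"
      using gauss_map_approximation_lower_bound[OF x q] by metis
    let ?g = "(gauss_map ^^ n) x"
    have g: "?g > 0" using funpow_gauss_map_irrational[OF x] by simp
    have "ln ((3/2 :: real) ^ n) \<le> ln (4 * real q)"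
      using n(1) q' by (subst ln_le_cancel_iff) auto
    then have nl: "real n * l \<le> ln 4 + ln (real q)"
      using q' by (simp add: l_def ln_realpow ln_mult)
    have "?g / 4 \<le> real q ^ 2 * real q powr (- (2 + c))"
      using n(2) le by (meson mult_left_mono order_trans zero_le_power2)
    also have "\<dots> = real q powr 2 * real q powr (- (2 + c))"
      using q' by simp
    also have "\<dots> = real q powr (- c)"
      unfolding powr_add[symmetric] by simp
    finally have "ln (?g / 4) \<le> ln (real q powr (- c))"
      using g q' by (subst ln_le_cancel_iff) auto
    then have "ln ?g - ln 4 \<le> - c * ln (real q)"
      using g q' by (simp add: ln_div ln_powr)
    then have "c * ln (real q) \<le> e * real n + K + ln 4" using K[of n] by linarith
    also have "e * real n = c / 2 * (real n * l)" by (simp add: e_def)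
    also have "\<dots> \<le> c / 2 * (ln 4 + ln (real q))"
      using nl c by (intro mult_left_mono) auto
    finally have "c / 2 * ln (real q) \<le> c / 2 * ln 4 + K + ln 4"
      by (simp add: algebra_simps)
    then have "ln (real q) \<le> (c / 2 * ln 4 + K + ln 4) / (c / 2)"
      using c by (subst pos_le_divide_eq) (auto simp: mult.commute)
    then have qB: "real q \<le> B"
      unfolding B_def using q' by (metis exp_le_cancel_iff exp_ln less_le_trans zero_less_one)
    \<comment> \<open>The numerators must be bounded too: the error is at most 1 and
      \<open>0 < x < 1\<close>, hence \<open>\<bar>p\<bar> \<le> 2 q\<close>.\<close>
    have "real q powr (- (2 + c)) \<le> real q powr 0"
      using q' c by (intro powr_mono) auto
    then have "\<bar>x - of_int p / real q\<bar> \<le> 1" using le q' by simp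
    then have "\<bar>of_int p / real q\<bar> \<le> 2" using x by linarith
    then have "\<bar>real_of_int p\<bar> \<le> 2 * real q" using q' by (simp add: divide_le_eq)
    with qB show ?thesis by simp
  qed
  have "?S \<subseteq> {- \<lceil>2 * B\<rceil>..\<lceil>2 * B\<rceil>} \<times> {..nat \<lceil>B\<rceil>}"
  proof
    fix z assume z: "z \<in> ?S"
    obtain p q where pq: "z = (p, q)" by (cases z)
    have "real q \<le> B" "\<bar>real_of_int p\<bar> \<le> 2 * B" using bound z pq by auto
    then have "int q \<le> \<lceil>B\<rceil>" "p \<le> \<lceil>2 * B\<rceil>" "- p \<le> \<lceil>2 * B\<rceil>" by linarith+
    then show "z \<in> {- \<lceil>2 * B\<rceil>..\<lceil>2 * B\<rceil>} \<times> {..nat \<lceil>B\<rceil>}" unfolding pq by auto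
  qed
  then have "finite ?S" by (rule finite_subset) auto
  with inf show False by contradiction
qed

section \<open>Sublinear growth along orbits of a measure-preserving map\<close>

text \<open>Tail-sum estimate: at each point the number of \<open>n\<close> with
  \<open>e n < f x\<close> is at most \<open>f x / e\<close> rounded up, and integrating this count
  bounds all partial sums.\<close>

lemma (in prob_space) summable_prob_gt_linear:
  fixes f :: "'a \<Rightarrow> real"
  assumes f: "integrable M f" and nonneg: "\<And>x. x \<in> space M \<Longrightarrow> f x \<ge> 0" and e: "e > 0"
  shows "summable (\<lambda>n. prob {x \<in> space M. f x > e * real n})"
proof -
  have [measurable]: "f \<in> borel_measurable M" using f by auto
  let ?A = "\<lambda>n. {x \<in> space M. f x > e * real n}"
  show ?thesis
  proof (rule summableI_nonneg_bounded)
    fix N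
    have pointwise: "(\<Sum>n<N. indicator (?A n) x) \<le> f x / e + 1" if x: "x \<in> space M" for x
    proof -
      have sub: "{n. n < N \<and> e * real n < f x} \<subseteq> {..<nat \<lceil>f x / e\<rceil>}"
      proof
        fix n assume "n \<in> {n. n < N \<and> e * real n < f x}"
        then have "real n < f x / e" using e by (simp add: field_simps)
        then show "n \<in> {..<nat \<lceil>f x / e\<rceil>}" by simp linarith
      qed
      have "(\<Sum>n<N. indicator (?A n) x) = (\<Sum>n<N. if e * real n < f x then 1 else 0 :: real)"
        using x by (intro sum.cong) (auto simp: indicator_def)
      also have "\<dots> = real (card {n. n < N \<and> e * real n < f x})"
        by (simp flip: sum.inter_filter)
      also have "\<dots> \<le> real (nat \<lceil>f x / e\<rceil>)"
        using card_mono[OF _ sub] by simp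
      also have "\<dots> \<le> f x / e + 1"
      proof -
        have "f x / e \<ge> 0" using nonneg x e by simp
        then show ?thesis by linarith
      qed
      finally show ?thesis .
    qed
    have "(\<Sum>n<N. prob (?A n)) = (\<Sum>n<N. expectation (indicator (?A n)))"
      by simp
    also have "\<dots> = expectation (\<lambda>x. \<Sum>n<N. indicator (?A n) x)"
      by (subst Bochner_Integration.integral_sum) (auto simp: emeasure_eq_measure)
    also have "\<dots> \<le> expectation (\<lambda>x. f x / e + 1)"
      using f pointwise
      by (intro integral_mono) (auto simp: emeasure_eq_measure)
    finally show "(\<Sum>n<N. prob (?A n)) \<le> expectation (\<lambda>x. f x / e + 1)" .
  qed simp
qed

lemma emeasure_vimage_funpow_invariant:
  assumes T: "T \<in> measurable M M" and inv: "invariant_measure T M" and A: "A \<in> sets M"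
  shows "emeasure M ((T ^^ n) -` A \<inter> space M) = emeasure M A"
proof (induction n)
  case 0
  show ?case using A by (simp add: sets.Int_space_eq2)
next
  case (Suc n)
  have Tn: "T ^^ n \<in> measurable M M" using T by (rule measurable_compose_n)
  have "(T ^^ Suc n) -` A \<inter> space M = T -` ((T ^^ n) -` A \<inter> space M) \<inter> space M"
    using measurable_space[OF T] by (auto simp: funpow_swap1)
  moreover have "(T ^^ n) -` A \<inter> space M \<in> sets M" using Tn A by (rule measurable_sets)
  ultimately have "emeasure M ((T ^^ Suc n) -` A \<inter> space M) =
      emeasure M ((T ^^ n) -` A \<inter> space M)"
    using inv unfolding invariant_measure_def by metis
  then show ?case using Suc.IH by (rule trans)
qed

text \<open>By invariance, the event that \<open>f\<close> exceeds \<open>e n\<close> at the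
  \<open>n\<close>-th iterate is as likely as the event that \<open>f\<close> itself exceeds
  \<open>e n\<close>. The tail sums of \<open>f\<close> therefore feed Borel-Cantelli along the
  orbit.\<close>

lemma (in prob_space) AE_funpow_sublinear:
  fixes f :: "'a \<Rightarrow> real"
  assumes T: "T \<in> measurable M M" and inv: "invariant_measure T M"
    and f: "integrable M f" and nonneg: "\<And>x. x \<in> space M \<Longrightarrow> f x \<ge> 0" and e: "e > 0"
  shows "AE x in M. eventually (\<lambda>n. f ((T ^^ n) x) \<le> e * real n) sequentially"
proof -
  have [measurable]: "f \<in> borel_measurable M" using f by auto
  have Tn [measurable]: "T ^^ n \<in> measurable M M" for n
    using T by (rule measurable_compose_n)
  let ?A = "\<lambda>n. {x \<in> space M. f x > e * real n}"
  let ?B = "\<lambda>n. (T ^^ n) -` ?A n \<inter> space M"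
  have B: "?B n \<in> sets M" for n
    using Tn by (rule measurable_sets) measurable
  have "prob (?B n) = prob (?A n)" for n
    using emeasure_vimage_funpow_invariant[OF T inv, of "?A n" n] by (simp add: measure_def)
  then have "summable (\<lambda>n. prob (?B n))"
    using summable_prob_gt_linear[OF f nonneg e] by simp
  then have "AE x in M. eventually (\<lambda>n. x \<in> space M - ?B n) sequentially"
    using B by (intro borel_cantelli_AE1) (auto simp: emeasure_eq_measure)
  then show ?thesis
  proof eventually_elim
    case (elim x)
    then show ?case
    proof eventually_elim
      case (elim n)
      then show ?case using measurable_space[OF Tn, of x n] by auto
    qed
  qed
qed

section \<open>Extremality\<close>

text \<open>Irrationality puts \<open>1 / x\<close> strictly between consecutive integers, so the
  floor is constant near \<open>x\<close> and the map is locally a translate of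
  \<open>1 / y\<close>.\<close>

lemma deriv_gauss_map:
  assumes "0 < x" "x \<notin> \<rat>"
  shows "deriv gauss_map x = - (1 / x ^ 2)"
proof (rule DERIV_imp_deriv)
  have "1 / x \<notin> \<int>"
  proof
    assume "1 / x \<in> \<int>"
    then have "inverse (1 / x) \<in> \<rat>" using Ints_subset_Rats by (intro Rats_inverse) auto
    with assms show False by simp
  qed
  then have "1 / x \<noteq> of_int \<lfloor>1 / x\<rfloor>" by (metis Ints_of_int)
  then have fl: "of_int \<lfloor>1 / x\<rfloor> < 1 / x" "1 / x < of_int \<lfloor>1 / x\<rfloor> + 1"
    using of_int_floor_le[of "1 / x"] by linarith+
  have lim: "((\<lambda>y. 1 / y) \<longlongrightarrow> 1 / x) (nhds x)"
    using assms by (intro tendsto_intros) (auto simp: filterlim_ident)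
  have "eventually (\<lambda>y. 0 < y \<and> of_int \<lfloor>1 / x\<rfloor> < 1 / y \<and> 1 / y < of_int \<lfloor>1 / x\<rfloor> + 1) (nhds x)"
    using order_tendstoD(1)[OF lim fl(1)] order_tendstoD(2)[OF lim fl(2)]
      eventually_nhds_in_open[of "{0<..}" x] assms by (auto simp: eventually_conj_iff)
  then have ev: "eventually (\<lambda>y. gauss_map y = 1 / y - of_int \<lfloor>1 / x\<rfloor>) (nhds x)"
  proof eventually_elim
    case (elim y)
    then have "\<lfloor>1 / y\<rfloor> = \<lfloor>1 / x\<rfloor>" by (intro floor_unique) auto
    with elim show ?case by (simp add: gauss_map_def)
  qed
  show "(gauss_map has_field_derivative - (1 / x ^ 2)) (at x)"
    unfolding DERIV_cong_ev[OF refl ev refl] using assms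
    by (auto intro!: derivative_eq_intros simp: power2_eq_square)
qed

section \<open>Measurability of the set of very well approximable numbers\<close>

lemma measurable_gauss_map: "gauss_map \<in> borel_measurable borel"
  unfolding gauss_map_def[abs_def] by measurable

text \<open>Through \<open>to_nat\<close>, infiniteness becomes unboundedness of the codes, which is
  expressed by countable quantifiers only.\<close>

lemma measurable_infinite_Collect:
  fixes P :: "'i :: countable \<Rightarrow> 'a \<Rightarrow> bool"
  assumes [measurable]: "\<And>i. Measurable.pred M (P i)"
  shows "Measurable.pred M (\<lambda>x. infinite {i. P i x})"
proof -
  have "infinite {i. P i x} \<longleftrightarrow> (\<forall>m. \<exists>i. to_nat i > m \<and> P i x)" for x
  proof -
    have "infinite {i. P i x} \<longleftrightarrow> infinite (to_nat ` {i. P i x})"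
      by (simp add: finite_image_iff)
    then show ?thesis by (simp only: infinite_nat_iff_unbounded) blast
  qed
  then show ?thesis by simp
qed

lemma measurable_psi_approximable: "Measurable.pred borel (psi_approximable \<psi>)"
proof -
  have "\<rat> \<in> sets (borel :: real measure)"
    by (rule sets.countable) (auto simp: countable_rat)
  then have [measurable]: "Measurable.pred borel (\<lambda>x :: real. x \<in> \<rat>)" by measurable
  have "Measurable.pred borel (\<lambda>x. infinite {i. case i of (p :: int, q :: nat) \<Rightarrow>
      q \<ge> 1 \<and> coprime p (int q) \<and> \<bar>x - of_int p / real q\<bar> \<le> \<psi> q})"
    by (rule measurable_infinite_Collect) (simp add: case_prod_beta)
  then show ?thesis unfolding psi_approximable_def[abs_def] by measurable
qed

lemma psi_approximable_mono:
  assumes "psi_approximable \<psi> x" "\<And>q. q \<ge> 1 \<Longrightarrow> \<psi> q \<le> \<phi> q"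
  shows "psi_approximable \<phi> x"
proof -
  have "{(p :: int, q :: nat). q \<ge> 1 \<and> coprime p (int q) \<and> \<bar>x - of_int p / real q\<bar> \<le> \<psi> q} \<subseteq>
      {(p, q). q \<ge> 1 \<and> coprime p (int q) \<and> \<bar>x - of_int p / real q\<bar> \<le> \<phi> q}"
    using assms(2) by (auto intro: order_trans)
  then show ?thesis
    using assms(1) finite_subset unfolding psi_approximable_def by blast
qed

text \<open>Membership in \<open>null_sets\<close> includes measurability. The uncountable union
  over \<open>c\<close> reduces to \<open>c = 1 / (k + 1)\<close>, since lowering \<open>c\<close>
  weakens the condition for \<open>q \<ge> 1\<close>.\<close>

lemma measurable_very_well_approximable: "Measurable.pred borel very_well_approximable"
proof -
  have "very_well_approximable x \<longleftrightarrow>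
      (\<exists>k. psi_approximable (\<lambda>q. real q powr (- (2 + inverse (real (Suc k))))) x)" for x
  proof
    assume "very_well_approximable x"
    then obtain c where c: "c > 0" "psi_approximable (\<lambda>q. real q powr (- (2 + c))) x"
      unfolding very_well_approximable_def by blast
    obtain k where "inverse (real (Suc k)) < c" using reals_Archimedean c(1) by blast
    then have "psi_approximable (\<lambda>q. real q powr (- (2 + inverse (real (Suc k))))) x"
      by (intro psi_approximable_mono[OF c(2)] powr_mono) auto
    then show "\<exists>k. psi_approximable (\<lambda>q. real q powr (- (2 + inverse (real (Suc k))))) x" ..
  next
    assume "\<exists>k. psi_approximable (\<lambda>q. real q powr (- (2 + inverse (real (Suc k))))) x"
    then show "very_well_approximable x"
      unfolding very_well_approximable_def by (metis inverse_positive_iff_positive of_nat_0_less_iff zero_less_Suc)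
  qed
  then have eq: "very_well_approximable = (\<lambda>x. \<exists>k.
      psi_approximable (\<lambda>q. real q powr (- (2 + inverse (real (Suc k))))) x)" by (rule ext)
  show ?thesis
    unfolding eq by (intro pred_intros_countable measurable_psi_approximable)
qed

theorem theorem2p1:
  fixes \<mu> :: "real measure"
  assumes "prob_space \<mu>"
    and "sets \<mu> = sets (restrict_space borel ({0..1} - \<rat>))"
    and "invariant_measure gauss_map \<mu>"
    and "integrable \<mu> (\<lambda>x. ln \<bar>deriv gauss_map x\<bar>)"
  shows "extremal \<mu>"
proof -
  interpret prob_space \<mu> by fact
  have space: "space \<mu> = {0..1} - \<rat>"
    using sets_eq_imp_space_eq[OF assms(2)] by (simp add: space_restrict_space)
  have x: "0 < x" "x < 1" "x \<notin> \<rat>" if "x \<in> space \<mu>" for x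
    using that Rats_0 Rats_1 unfolding space by (auto simp: less_le)
  \<comment> \<open>The irrationals of the unit interval are mapped into themselves, so the map can
    be iterated on the space of \<open>\<mu>\<close>.\<close>
  have "gauss_map \<in> measurable \<mu> (restrict_space borel ({0..1} - \<rat>))"
  proof (rule measurable_restrict_space2)
    show "gauss_map \<in> borel_measurable \<mu>"
      unfolding measurable_cong_sets[OF assms(2) refl]
      using measurable_gauss_map by (rule measurable_restrict_space1)
    show "gauss_map \<in> space \<mu> \<rightarrow> {0..1} - \<rat>"
      using gauss_map_irrational x by (metis DiffI Pi_I atLeastAtMost_iff less_imp_le)
  qed
  then have T: "gauss_map \<in> measurable \<mu> \<mu>"
    by (simp add: measurable_cong_sets[OF refl assms(2)])
  have "ln \<bar>deriv gauss_map y\<bar> = 2 * (- ln y)" if "y \<in> space \<mu>" for y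
    using x[OF that] by (simp add: deriv_gauss_map ln_div ln_realpow)
  then have "integrable \<mu> (\<lambda>y. ln \<bar>deriv gauss_map y\<bar>) \<longleftrightarrow> integrable \<mu> (\<lambda>y. 2 * (- ln y))"
    by (intro Bochner_Integration.integrable_cong) auto
  then have int: "integrable \<mu> (\<lambda>y. - ln y)" using assms(4) by simp
  \<comment> \<open>Countably many rates \<open>1 / (k + 1)\<close> suffice for every
    \<open>e > 0\<close> and share one null set.\<close>
  have "AE y in \<mu>. \<forall>k. eventually
      (\<lambda>n. - ln ((gauss_map ^^ n) y) \<le> inverse (real (Suc k)) * real n) sequentially"
    unfolding AE_all_countable
    by (intro allI AE_funpow_sublinear[OF T assms(3) int]) (auto simp: less_imp_le x)
  then have "AE y in \<mu>. \<not> very_well_approximable y"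
    using AE_space
  proof eventually_elim
    case (elim y)
    show ?case
    proof (rule not_very_well_approximable[OF x[OF elim(2)]])
      fix e :: real assume "e > 0"
      then obtain k where k: "inverse (real (Suc k)) < e"
        using reals_Archimedean by blast
      let ?f = "\<lambda>n. - ln ((gauss_map ^^ n) y)"
      from elim(1) obtain N where N: "\<And>n. n \<ge> N \<Longrightarrow> ?f n \<le> inverse (real (Suc k)) * real n"
        unfolding eventually_sequentially by blast
      \<comment> \<open>The finite sum dominates each term before \<open>N\<close>, turning the
        eventual bound into one for all \<open>n\<close>.\<close>
      have "?f n \<le> e * real n + (\<Sum>i<N. \<bar>?f i\<bar>)" for n
      proof (cases "n \<ge> N")
        case True
        have "inverse (real (Suc k)) * real n \<le> e * real n"
          using k by (intro mult_right_mono) auto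
        moreover have "0 \<le> (\<Sum>i<N. \<bar>?f i\<bar>)" by (intro sum_nonneg) auto
        ultimately show ?thesis using N[OF True] by linarith
      next
        case False
        then have "\<bar>?f n\<bar> \<le> (\<Sum>i<N. \<bar>?f i\<bar>)"
          by (intro member_le_sum) auto
        moreover have "e * real n \<ge> 0" using \<open>e > 0\<close> by simp
        ultimately show ?thesis by linarith
      qed
      then show "\<exists>K. \<forall>n. ?f n \<le> e * real n + K" by blast
    qed
  qed
  moreover have "{y \<in> space \<mu>. very_well_approximable y} \<in> sets \<mu>"
    unfolding pred_def[symmetric] measurable_cong_sets[OF assms(2) refl]
    using measurable_very_well_approximable by (rule measurable_restrict_space1)
  ultimately show ?thesis
    unfolding extremal_def by (subst AE_iff_null_sets) auto
qed

end
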